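(* Let $X$ be a non-empty at most countable set and let $T\colon X\to X$ be a map such that the directed graph $G_T=(V_T,E_T)$, where $V_T=X$ and $E_T=\{(Tx,x): x\in X\}$, is connected. Then exactly one of the following holds: (i) $G_T$ is a rootless directed tree (i.e. a directed tree having no root); (ii) $G_T$ satisfies both conditions below: (a) there exist an integer $\kappa\ge 1$ and distinct vertices $v_0,\ldots,v_{\kappa-1}\in V_T$ such that $(v_j,v_{j+1})\in E_T$ for every integer $0\le j\le \kappa-2$, and $(v_{\kappa-1},v_0)\in E_T$; (b) there exists a partition $\mathcal R$ of $V_T\setminus\{v_0,\ldots,v_{\kappa-1}\}$ such that for every $R\in\mathcal R$ the graph $(R,E_R)$, where $E_R=\{(u,w)\in E_T: u,w\in R\}$, is a rooted directed tree with root $\omega_R$ having the property that there exists exactly one $i_R\in\{0,1,\ldots,\kappa-1\}$ satisfying $(v_{i_R},\omega_R)\in E_T$.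
   Context: A directed graph is a pair $G=(V,E)$ with $V$ a non-empty at most countable set and $E\subset V\times V$ (loops $(v,v)$ are allowed). The in-degree of $v$ is $\#\{w\in V:(w,v)\in E\}$. A path from $v$ to $w$ is a sequence $(u_0,\ldots,u_k)$ of vertices with $u_0=v$, $u_k=w$ and $(u_i,u_{i+1})\in E$ for $0\le i\le k-1$; a cycle is such a path with $k\ge 1$ and $u_0=u_k$. $G$ is connected if any two distinct vertices can be joined by a finite sequence of vertices in which any two consecutive vertices $u,u'$ satisfy $(u,u')\in E$ or $(u',u)\in E$. A directed tree is a connected directed graph with no cycles in which every vertex has in-degree at most $1$. A directed tree has at most one vertex of in-degree $0$; if it exists, it is called the root, and the tree is called rooted; otherwise it is rootless. The partition $\mathcal R$ may be empty (when $V_T=\{v_0,\ldots,v_{\kappa-1}\}$). *)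

theory Defs
  imports
    "Graph_Theory.Digraph_Component"
    "Graph_Theory.Vertex_Walk"
    "HOL-Library.Extended_Nat"
    "HOL-Library.Countable_Set"
    "HOL-Library.Disjoint_Sets"
begin

text \<open>
  The absence of parallel arcs expresses that the arcs form a subset of
  \<open>V \<times> V\<close>; loops are allowed.
\<close>

definition directed_graph :: "('a, 'b) pre_digraph \<Rightarrow> bool" where
  "directed_graph G \<longleftrightarrow> nomulti_digraph G \<and> verts G \<noteq> {} \<and> countable (verts G)"

text \<open>
  The library's \<^const>\<open>in_degree\<close> is \<open>0\<close> when infinitely many arcs enter a
  vertex, so it could not be used to bound in-degrees in infinite graphs.
\<close>

definition in_deg :: "('a, 'b) pre_digraph \<Rightarrow> 'a \<Rightarrow> enat" where
  "in_deg G v = (if finite (in_arcs G v) then enat (in_degree G v) else \<infinity>)"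

text \<open>
  A cycle is a closed path with at least one edge, given by its sequence of
  vertices \<open>u\<^sub>0, \<dots>, u\<^sub>k\<close>; no distinctness is required, unlike in
  \<^const>\<open>pre_digraph.cycle\<close>.
\<close>

definition vertex_cycle :: "('a, 'b) pre_digraph \<Rightarrow> 'a list \<Rightarrow> bool" where
  "vertex_cycle G p \<longleftrightarrow> vwalk p G \<and> vwalk_length p \<ge> 1 \<and> hd p = last p"

definition directed_tree :: "('a, 'b) pre_digraph \<Rightarrow> bool" where
  "directed_tree G \<longleftrightarrow>
     directed_graph G \<and> Digraph_Component.connected G \<and>
     (\<nexists>p. vertex_cycle G p) \<and> (\<forall>v\<in>verts G. in_deg G v \<le> 1)"

definition is_root :: "('a, 'b) pre_digraph \<Rightarrow> 'a \<Rightarrow> bool" where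
  "is_root G \<omega> \<longleftrightarrow> \<omega> \<in> verts G \<and> in_deg G \<omega> = 0"

definition rooted_directed_tree :: "('a, 'b) pre_digraph \<Rightarrow> 'a \<Rightarrow> bool" where
  "rooted_directed_tree G \<omega> \<longleftrightarrow> directed_tree G \<and> is_root G \<omega>"

definition rootless_directed_tree :: "('a, 'b) pre_digraph \<Rightarrow> bool" where
  "rootless_directed_tree G \<longleftrightarrow> directed_tree G \<and> (\<nexists>\<omega>. is_root G \<omega>)"

text \<open>Edges point from \<open>T x\<close> to \<open>x\<close>.\<close>

definition map_digraph :: "'a set \<Rightarrow> ('a \<Rightarrow> 'a) \<Rightarrow> ('a, 'a \<times> 'a) pre_digraph" where
  "map_digraph X T = \<lparr>verts = X, arcs = {(T x, x) | x. x \<in> X}, tail = fst, head = snd\<rparr>"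

end

theory Submission
  imports Defs "HOL-Combinatorics.Orbits"
begin

text \<open>
  A vertex lies on a cycle of \<open>G\<^sub>T\<close> iff it is periodic under \<open>T\<close>, and connectedness
  means that any two forward \<open>T\<close>-orbits meet. Without periodic points \<open>G\<^sub>T\<close> is therefore a
  tree, rootless because \<open>(T x, x)\<close> enters every \<open>x\<close>. Otherwise every forward orbit ends up in
  the orbit \<open>C\<close> of one periodic point. Read backwards, \<open>C\<close> is the cycle in (ii), and
  each other vertex has a unique last iterate \<open>\<omega>\<close> outside \<open>C\<close>; the classes of vertices with
  the same \<open>\<omega>\<close> form the partition.
\<close>

section \<open>Arcs and in-degrees in induced subgraphs\<close>

lemma dominates_map_digraph [simp]:
  "u \<rightarrow>\<^bsub>map_digraph X T\<^esub> w \<longleftrightarrow> w \<in> X \<and> u = T w"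
  by (auto simp: map_digraph_def arcs_ends_conv image_iff)

lemma verts_map_digraph [simp]: "verts (map_digraph X T) = X"
  by (simp add: map_digraph_def)

lemma dominates_induce_map_digraph [simp]:
  "u \<rightarrow>\<^bsub>map_digraph X T \<restriction> R\<^esub> w \<longleftrightarrow> w \<in> X \<inter> R \<and> T w \<in> R \<and> u = T w"
  by (auto simp: map_digraph_def arcs_ends_conv image_iff)

text \<open>Lets the lemmas on induced subgraphs speak about the whole graph; invariance of
  \<open>X\<close> ensures that no arc \<open>(T x, x)\<close> is dropped.\<close>

lemma induce_map_digraph_self:
  assumes "T ` X \<subseteq> X"
  shows "map_digraph X T \<restriction> X = map_digraph X T"
  using assms by (auto simp: map_digraph_def induce_subgraph_def)

lemma nomulti_induce_map_digraph: "nomulti_digraph (map_digraph X T \<restriction> R)"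
  by unfold_locales (auto simp: map_digraph_def arc_to_ends_def)

text \<open>The only arc that can enter \<open>w\<close> is \<open>(T w, w)\<close>, and it survives
  the restriction exactly when its tail does.\<close>

lemma in_deg_induce_map_digraph:
  assumes "w \<in> X \<inter> R"
  shows "in_deg (map_digraph X T \<restriction> R) w = (if T w \<in> R then 1 else 0)"
proof -
  have "in_arcs (map_digraph X T \<restriction> R) w = (if T w \<in> R then {(T w, w)} else {})"
    using assms by (auto simp: map_digraph_def in_arcs_def)
  then show ?thesis
    by (simp add: in_deg_def in_degree_def one_enat_def zero_enat_def)
qed

section \<open>Walks, cycles and periodic points\<close>

lemma vwalk_map_digraph_funpow:
  assumes "vwalk p (map_digraph X T)"
  shows "hd p = (T ^^ vwalk_length p) (last p)"
  using assms
proof (induction p rule: vwalk_induct)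
  case (Cons u v es)
  then show ?case by simp
qed simp

text \<open>\<open>orbit T x\<close> collects the iterates with positive exponent only, so
  \<open>x \<in> orbit T x\<close> expresses that \<open>x\<close> is periodic.\<close>

lemma closed_vwalk_imp_periodic:
  assumes "vwalk p (map_digraph X T)" "hd p = last p" "vwalk_length p > 0"
  shows "last p \<in> orbit T (last p)"
proof -
  have "last p = (T ^^ vwalk_length p) (last p)"
    using vwalk_map_digraph_funpow[OF assms(1)] assms(2) by simp
  then show ?thesis
    using assms(3) unfolding orbit_altdef by blast
qed

lemma funpow_in_self_map:
  assumes "T ` X \<subseteq> X" "x \<in> X"
  shows "(T ^^ n) x \<in> X"
  using assms by (induction n) auto

text \<open>The iterates are listed in descending order because arcs run against
  \<open>T\<close>.\<close>

lemma vwalk_map_digraph_iterates: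
  assumes "T ` X \<subseteq> X" "x \<in> X"
  shows "vwalk (map (\<lambda>i. (T ^^ i) x) (rev [0..<Suc n])) (map_digraph X T)"
proof (induction n)
  case (Suc n)
  have "vwalk ((T ^^ Suc n) x # map (\<lambda>i. (T ^^ i) x) (rev [0..<Suc n])) (map_digraph X T)"
    using Suc funpow_in_self_map[OF assms] funpow_in_self_map[OF assms, of "Suc n"]
    by (intro vwalk_consI) auto
  then show ?case by simp
qed (use assms in \<open>auto simp: vwalk_def\<close>)

lemma periodic_imp_vertex_cycle:
  assumes "T ` X \<subseteq> X" "x \<in> X" "x \<in> orbit T x"
  obtains p where "vertex_cycle (map_digraph X T) p"
proof -
  obtain n where n: "n > 0" "(T ^^ n) x = x"
    using assms(3) by (auto simp: orbit_altdef)
  let ?p = "map (\<lambda>i. (T ^^ i) x) (rev [0..<Suc n])"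
  have "hd ?p = x" "last ?p = x"
    using n by (auto simp: last_map last_rev)
  then have "vertex_cycle (map_digraph X T) ?p"
    using vwalk_map_digraph_iterates[OF assms(1,2), of n] n by (simp add: vertex_cycle_def)
  then show thesis by (rule that)
qed

lemma vwalk_induce_subgraphD:
  assumes "vwalk p (G \<restriction> R)" "R \<subseteq> verts G"
  shows "vwalk p G"
  using assms by (fastforce simp: vwalk_def arcs_ends_conv)

text \<open>The bound on in-degrees is automatic, and a cycle inside \<open>R\<close> is a cycle of
  the whole graph, so it would put a periodic point into \<open>R\<close>.\<close>

lemma directed_tree_induce_map_digraph:
  assumes "R \<subseteq> X" "R \<noteq> {}" "countable R"
    and "Digraph_Component.connected (map_digraph X T \<restriction> R)"
    and "\<And>x. x \<in> X \<Longrightarrow> x \<in> orbit T x \<Longrightarrow> x \<notin> R"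
  shows "directed_tree (map_digraph X T \<restriction> R)"
proof -
  have "False" if "vertex_cycle (map_digraph X T \<restriction> R) p" for p
  proof -
    have p: "vwalk p (map_digraph X T)" "last p \<in> R" "hd p = last p" "vwalk_length p > 0"
      using that assms(1) vwalk_induce_subgraphD[of p "map_digraph X T" R]
      by (auto simp: vertex_cycle_def vwalk_def)
    then show False using closed_vwalk_imp_periodic[of p X T] assms(1,5) by blast
  qed
  moreover have "in_deg (map_digraph X T \<restriction> R) w \<le> 1" if "w \<in> R" for w
    using that assms(1) by (subst in_deg_induce_map_digraph) auto
  ultimately show ?thesis
    using assms by (auto simp: directed_tree_def directed_graph_def nomulti_induce_map_digraph)
qed

section \<open>Connectedness in terms of forward orbits\<close>

text \<open>Induction along an undirected path starting at \<open>x\<close>: an edge moves the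
  current endpoint one step along or against \<open>T\<close>, which is absorbed by raising one of
  the two exponents.\<close>

lemma connected_map_digraph_orbits_meet:
  assumes "Digraph_Component.connected (map_digraph X T)" "x \<in> X" "y \<in> X"
  obtains m n where "(T ^^ m) x = (T ^^ n) y"
proof -
  have "(x, y) \<in> rtrancl_on X ((arcs_ends (map_digraph X T))\<^sup>s)"
    using assms by (simp add: connected_conv)
  then have "\<exists>m n. (T ^^ m) x = (T ^^ n) y"
  proof (induction rule: rtrancl_on_induct)
    case base
    then show ?case by blast
  next
    case (step y z)
    then obtain m n where mn: "(T ^^ m) x = (T ^^ n) y" by blast
    from step consider "y = T z" | "z = T y" by (auto simp: symcl_def)
    then show ?case
    proof cases
      case 1
      then have "(T ^^ m) x = (T ^^ Suc n) z" using mn by (simp add: funpow_swap1)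
      then show ?thesis by blast
    next
      case 2
      then have "(T ^^ Suc m) x = (T ^^ n) z" using mn by (simp add: funpow_swap1)
      then show ?thesis by blast
    qed
  qed
  then show thesis using that by blast
qed

text \<open>\<open>\<omega>\<close> serves as a hub: the forward orbit of each vertex is an
  undirected path to it, and this path stays inside \<open>R\<close>.\<close>

lemma connected_if_iterates_reach:
  assumes "R \<subseteq> X" "\<omega> \<in> R"
    and "\<And>x. x \<in> R \<Longrightarrow> \<exists>n. (T ^^ n) x = \<omega> \<and> (\<forall>i\<le>n. (T ^^ i) x \<in> R)"
  shows "Digraph_Component.connected (map_digraph X T \<restriction> R)"
proof -
  let ?E = "(arcs_ends (map_digraph X T \<restriction> R))\<^sup>s"
  have to_iterate: "(x, (T ^^ n) x) \<in> rtrancl_on R ?E" if "\<forall>i\<le>n. (T ^^ i) x \<in> R" for x n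
    using that
  proof (induction n)
    case (Suc n)
    have "(T ^^ n) x \<in> R" "(T ^^ Suc n) x \<in> R"
      using Suc.prems le_Suc_eq by blast+
    then have "((T ^^ Suc n) x, (T ^^ n) x) \<in> arcs_ends (map_digraph X T \<restriction> R)"
      using assms(1) by auto
    then have "((T ^^ n) x, (T ^^ Suc n) x) \<in> ?E"
      unfolding symcl_def by force
    moreover have "(x, (T ^^ n) x) \<in> rtrancl_on R ?E"
      using Suc by simp
    ultimately show ?case
      using \<open>(T ^^ Suc n) x \<in> R\<close> by (metis rtrancl_on_into_rtrancl_on)
  qed auto
  have "(x, \<omega>) \<in> rtrancl_on R ?E" if "x \<in> R" for x
    using assms(3)[OF that] to_iterate by metis
  \<comment> \<open>Symmetry allows the path from \<open>x\<close> to \<open>\<omega>\<close> to be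
    continued by the reversed path of \<open>y\<close>.\<close>
  moreover have "sym (rtrancl_on R ?E)"
    by (intro rtrancl_on_sym) (auto simp: symcl_def sym_def)
  ultimately have "(x, y) \<in> rtrancl_on R ?E" if "x \<in> R" "y \<in> R" for x y
    using that by (meson rtrancl_on_trans symE)
  then show ?thesis
    using assms(2) by (auto simp: connected_conv)
qed

section \<open>Periodic orbits as cycles\<close>

lemma orbit_reversed_enumeration:
  assumes "c \<in> orbit T c"
  obtains k :: nat and v where "k \<ge> 1" "inj_on v {..<k}" "v ` {..<k} = orbit T c"
    "\<forall>j. j + 1 < k \<longrightarrow> v j = T (v (j + 1))" "v (k - 1) = T (v 0)"
proof -
  \<comment> \<open>This is the least positive period of \<open>c\<close>, so the first
    \<open>k\<close> iterates are distinct.\<close>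
  define k where "k = funpow_dist1 T c c"
  \<comment> \<open>The exponent counts down so that \<open>T\<close> leads from
    \<open>v (j + 1)\<close> to \<open>v j\<close>; the cycle closes at
    \<open>v (k - 1) = c\<close>, since \<open>T (v 0)\<close> is the \<open>k\<close>-th iterate of
    \<open>c\<close>.\<close>
  define v where "v = (\<lambda>j. (T ^^ (k - 1 - j)) c)"
  have k: "k \<ge> 1" "(T ^^ k) c = c"
    using assms funpow_dist1_prop[of c T c] by (auto simp: k_def)
  have inj: "inj_on (\<lambda>n. (T ^^ n) c) {0..<k}"
    unfolding k_def using assms by (rule inj_on_funpow_dist1)
  have bij: "bij_betw (\<lambda>j. k - 1 - j) {..<k} {0..<k}"
    by (rule bij_betw_byWitness[where f' = "\<lambda>j. k - 1 - j"]) auto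
  have "v ` {..<k} = (\<lambda>n. (T ^^ n) c) ` (\<lambda>j. k - 1 - j) ` {..<k}"
    by (simp add: v_def image_image)
  also have "\<dots> = orbit T c"
    using orbit_conv_funpow_dist1[OF assms] bij by (simp add: bij_betw_def k_def)
  finally have "v ` {..<k} = orbit T c" .
  moreover have "inj_on v {..<k}"
    using comp_inj_on[of "\<lambda>j. k - 1 - j" "{..<k}" "\<lambda>n. (T ^^ n) c"] inj bij
    by (simp add: bij_betw_def v_def comp_def)
  moreover have "v j = T (v (j + 1))" if "j + 1 < k" for j
  proof -
    have "k - 1 - j = Suc (k - 1 - (j + 1))" using that by simp
    then show ?thesis by (simp add: v_def)
  qed
  moreover have "v (k - 1) = T (v 0)"
    using k by (cases k) (auto simp: v_def)
  ultimately show thesis using that k(1) by blast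
qed

text \<open>Shows that (a) alone forces a periodic point: going once around the sequence applies
  \<open>T\<close> exactly \<open>k\<close> times.\<close>

lemma closed_sequence_imp_periodic:
  fixes v :: "nat \<Rightarrow> 'a"
  assumes "k \<ge> 1" "\<And>j. j + 1 < k \<Longrightarrow> v j = T (v (j + 1))" "v (k - 1) = T (v 0)"
  shows "v 0 \<in> orbit T (v 0)"
proof -
  have "(T ^^ j) (v j) = v 0" if "j < k" for j
    using that
  proof (induction j)
    case (Suc j)
    then show ?case using assms(2)[of j] by (simp add: funpow_swap1)
  qed simp
  from this[of "k - 1"] have "v 0 = (T ^^ Suc (k - 1)) (v 0)"
    using assms(1,3) unfolding funpow_Suc_right comp_def by simp
  then show ?thesis unfolding orbit_altdef using zero_less_Suc by blast
qed

section \<open>Basins of the entrances to an absorbing set\<close>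

text \<open>To be instantiated with the orbit of a periodic point as \<open>C\<close>; the partition
  rests only on orbits entering \<open>C\<close> and never leaving it.\<close>

locale absorbing_set =
  fixes X C :: "'a set" and T :: "'a \<Rightarrow> 'a"
  assumes T_self: "T ` X \<subseteq> X"
    and countable_X: "countable X"
    and C_closed: "T ` C \<subseteq> C"
    and absorbed: "x \<in> X \<Longrightarrow> \<exists>n. (T ^^ n) x \<in> C"
begin

definition entrances :: "'a set" where
  "entrances = {\<omega> \<in> X - C. T \<omega> \<in> C}"

text \<open>The descendants of \<open>\<omega>\<close> in the graph, with \<open>\<omega>\<close>
  itself included through \<open>n = 0\<close>.\<close>

definition basin :: "'a \<Rightarrow> 'a set" where
  "basin \<omega> = {x \<in> X. \<exists>n. (T ^^ n) x = \<omega>}"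

lemma stays_absorbed:
  assumes "(T ^^ m) x \<in> C" "m \<le> n"
  shows "(T ^^ n) x \<in> C"
proof -
  have "(T ^^ n) x = (T ^^ (n - m)) ((T ^^ m) x)"
    using assms(2) by (metis comp_apply funpow_add le_add_diff_inverse2)
  then show ?thesis using funpow_in_self_map[OF C_closed assms(1)] by simp
qed

text \<open>An orbit crosses into \<open>C\<close> at most once: if \<open>m < n\<close>, the
  iterate after \<open>m\<close> is already in \<open>C\<close>, hence so is the
  \<open>n\<close>-th.\<close>

lemma entrance_basin_unique:
  assumes "\<omega> \<in> entrances" "\<omega>' \<in> entrances" "x \<in> basin \<omega>" "x \<in> basin \<omega>'"
  shows "\<omega> = \<omega>'"
proof -
  obtain m n where mn: "(T ^^ m) x = \<omega>" "(T ^^ n) x = \<omega>'"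
    using assms by (auto simp: basin_def)
  have "(T ^^ Suc m) x \<in> C" "(T ^^ Suc n) x \<in> C" "(T ^^ m) x \<notin> C" "(T ^^ n) x \<notin> C"
    using mn assms(1,2) by (auto simp: entrances_def)
  then have "m = n"
    using stays_absorbed by (meson Suc_leI linorder_neqE_nat)
  then show ?thesis using mn by simp
qed

lemma entrance_in_basin:
  assumes "\<omega> \<in> entrances"
  shows "\<omega> \<in> basin \<omega>"
proof -
  have "(T ^^ 0) \<omega> = \<omega>" by simp
  then show ?thesis using assms unfolding basin_def entrances_def by blast
qed

lemma basin_subset:
  assumes "\<omega> \<in> entrances"
  shows "basin \<omega> \<subseteq> X - C"
proof
  fix x assume "x \<in> basin \<omega>"
  then obtain n where "x \<in> X" "(T ^^ n) x \<notin> C"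
    using assms by (auto simp: basin_def entrances_def)
  then show "x \<in> X - C" using stays_absorbed[of 0 x n] by auto
qed

lemma in_some_basin:
  assumes "x \<in> X - C"
  obtains \<omega> where "\<omega> \<in> entrances" "x \<in> basin \<omega>"
proof -
  obtain n where n: "(T ^^ n) x \<in> C" "\<And>m. m < n \<Longrightarrow> (T ^^ m) x \<notin> C"
    using assms absorbed[of x] exists_least_iff[of "\<lambda>n. (T ^^ n) x \<in> C"] by blast
  \<comment> \<open>The first entry time is positive because \<open>x\<close> starts outside
    \<open>C\<close>; the iterate just before it is the entrance.\<close>
  with assms obtain m where m: "n = Suc m" by (cases n) auto
  have "(T ^^ m) x \<in> entrances"
    using n m assms funpow_in_self_map[OF T_self, of x m] by (auto simp: entrances_def)
  then show thesis using that[of "(T ^^ m) x"] assms by (auto simp: basin_def)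
qed

lemma partition_on_basins: "partition_on (X - C) (basin ` entrances)"
proof (rule partition_onI)
  show "\<Union> (basin ` entrances) = X - C"
    using basin_subset in_some_basin by blast
  show "{} \<notin> basin ` entrances"
    using entrance_in_basin by blast
  show "disjnt p q" if "p \<in> basin ` entrances" "q \<in> basin ` entrances" "p \<noteq> q" for p q
    using that entrance_basin_unique unfolding disjnt_iff by blast
qed

lemma rooted_directed_tree_basin:
  assumes "\<omega> \<in> entrances" and periodic: "\<And>x. x \<in> X \<Longrightarrow> x \<in> orbit T x \<Longrightarrow> x \<in> C"
  shows "rooted_directed_tree (map_digraph X T \<restriction> basin \<omega>) \<omega>"
proof -
  have \<omega>: "\<omega> \<in> basin \<omega>" "\<omega> \<in> X" "T \<omega> \<in> C"
    using assms(1) entrance_in_basin by (auto simp: entrances_def)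
  have sub: "basin \<omega> \<subseteq> X - C" using basin_subset[OF assms(1)] .
  have reach: "\<exists>n. (T ^^ n) x = \<omega> \<and> (\<forall>i\<le>n. (T ^^ i) x \<in> basin \<omega>)" if x: "x \<in> basin \<omega>" for x
  proof -
    obtain n where n: "(T ^^ n) x = \<omega>" and "x \<in> X" using x by (auto simp: basin_def)
    have "(T ^^ i) x \<in> basin \<omega>" if "i \<le> n" for i
    proof -
      \<comment> \<open>The remaining \<open>n - i\<close> steps still lead to
        \<open>\<omega>\<close>, so intermediate iterates do not leave the basin.\<close>
      have "(T ^^ (n - i)) ((T ^^ i) x) = \<omega>"
        using n that by (metis comp_apply funpow_add le_add_diff_inverse2)
      then show ?thesis
        using funpow_in_self_map[OF T_self \<open>x \<in> X\<close>] by (auto simp: basin_def)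
    qed
    with n show ?thesis by blast
  qed
  have "Digraph_Component.connected (map_digraph X T \<restriction> basin \<omega>)"
    using sub \<omega> reach by (intro connected_if_iterates_reach) auto
  then have "directed_tree (map_digraph X T \<restriction> basin \<omega>)"
    using sub \<omega>(1) periodic countable_subset[OF _ countable_X, of "basin \<omega>"]
    by (intro directed_tree_induce_map_digraph) auto
  \<comment> \<open>The only possible arc into \<open>\<omega>\<close> has its tail in
    \<open>C\<close>, so \<open>\<omega>\<close> is a root of the induced graph.\<close>
  moreover have "T \<omega> \<notin> basin \<omega>" using sub \<omega>(3) by blast
  ultimately show ?thesis
    using \<omega> by (simp add: rooted_directed_tree_def is_root_def in_deg_induce_map_digraph)
qed

end

section \<open>The dichotomy\<close>

text \<open>A periodic \<open>x\<close> is reached again from each of its iterates, in particular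
  from one lying in the orbit of \<open>c\<close>.\<close>

lemma absorbing_orbit_contains_periodic:
  assumes "(T ^^ n) x \<in> orbit T c" "x \<in> orbit T x"
  shows "x \<in> orbit T c"
proof -
  have "(T ^^ n) x \<in> orbit T x" using assms(2) by (rule funpow_in_orbit)
  with assms(2) have "x \<in> orbit T ((T ^^ n) x)" by (rule orbit_swap)
  then show ?thesis using assms(1) by (rule orbit_trans)
qed

theorem theorem3p5:
  fixes X :: "'a set" and T :: "'a \<Rightarrow> 'a" and G :: "('a, 'a \<times> 'a) pre_digraph"
    and cond_i cond_ii :: bool
  assumes "X \<noteq> {}" and "countable X" and "T ` X \<subseteq> X"
    and "G = map_digraph X T"
    and "Digraph_Component.connected G"
    and "cond_i \<longleftrightarrow> rootless_directed_tree G"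
    and "cond_ii \<longleftrightarrow>
      (\<exists>(\<kappa>::nat) (v :: nat \<Rightarrow> 'a).
         (\<kappa> \<ge> 1 \<and> inj_on v {..<\<kappa>} \<and> v ` {..<\<kappa>} \<subseteq> verts G \<and>
          (\<forall>j. j + 1 < \<kappa> \<longrightarrow> v j \<rightarrow>\<^bsub>G\<^esub> v (j + 1)) \<and> v (\<kappa> - 1) \<rightarrow>\<^bsub>G\<^esub> v 0) \<and>
         (\<exists>\<R>. partition_on (verts G - v ` {..<\<kappa>}) \<R> \<and>
              (\<forall>R\<in>\<R>. \<exists>\<omega>. rooted_directed_tree (G \<restriction> R) \<omega> \<and>
                        (\<exists>!i. i < \<kappa> \<and> v i \<rightarrow>\<^bsub>G\<^esub> \<omega>))))"
  shows "(cond_i \<or> cond_ii) \<and> \<not> (cond_i \<and> cond_ii)"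
proof -
  note self = assms(3) and G = assms(4)
  have conn: "Digraph_Component.connected (map_digraph X T)" using assms(4,5) by simp
  show ?thesis
  proof (cases "\<exists>c\<in>X. c \<in> orbit T c")
    case False
    have "directed_tree (map_digraph X T \<restriction> X)"
      using assms(1,2) False conn
      by (intro directed_tree_induce_map_digraph) (auto simp: induce_map_digraph_self[OF self])
    moreover have "in_deg (map_digraph X T) x = 1" if "x \<in> X" for x
      using in_deg_induce_map_digraph[of x X X T] that self
      by (auto simp: induce_map_digraph_self[OF self])
    ultimately have "cond_i"
      unfolding assms(6) G
      by (auto simp: rootless_directed_tree_def is_root_def induce_map_digraph_self[OF self])
    moreover have "\<not> cond_ii"
    proof
      assume cond_ii
      then obtain k :: nat and v where kv: "k \<ge> 1" "v ` {..<k} \<subseteq> X"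
        "\<And>j. j + 1 < k \<Longrightarrow> v j = T (v (j + 1))" "v (k - 1) = T (v 0)"
        unfolding assms(7) G by auto
      then have "v 0 \<in> orbit T (v 0)" by (intro closed_sequence_imp_periodic) auto
      moreover have "v 0 \<in> X" using kv(1,2) by auto
      ultimately show False using False by blast
    qed
    ultimately show ?thesis by blast
  next
    case True
    then obtain c where c: "c \<in> X" "c \<in> orbit T c" by blast
    have "\<not> cond_i"
      unfolding assms(6) G rootless_directed_tree_def directed_tree_def
      using periodic_imp_vertex_cycle[OF self c] by blast
    have orbit_sub: "orbit T c \<subseteq> X"
      using funpow_in_self_map[OF self c(1)] by (auto simp: orbit_altdef)
    \<comment> \<open>The orbit of \<open>x\<close> meets that of \<open>c\<close>, and periodicity
      of \<open>c\<close> puts all its iterates, the zeroth included, into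
      \<open>orbit T c\<close>.\<close>
    have absorbed: "\<exists>n. (T ^^ n) x \<in> orbit T c" if "x \<in> X" for x
      using connected_map_digraph_orbits_meet[OF conn that c(1)] funpow_in_orbit[OF c(2)] by metis
    interpret absorbing_set X "orbit T c" T
    proof
      show "T ` orbit T c \<subseteq> orbit T c" by (intro image_subsetI orbit.step)
      show "\<exists>n. (T ^^ n) x \<in> orbit T c" if "x \<in> X" for x using that by (rule absorbed)
    qed (fact self assms(2))+
    have periodic: "x \<in> orbit T c" if "x \<in> X" "x \<in> orbit T x" for x
      using absorbed[OF that(1)] that(2) by (auto intro: absorbing_orbit_contains_periodic)
    obtain k :: nat and v where kv: "k \<ge> 1" "inj_on v {..<k}" "v ` {..<k} = orbit T c"
      "\<forall>j. j + 1 < k \<longrightarrow> v j = T (v (j + 1))" "v (k - 1) = T (v 0)"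
      by (rule orbit_reversed_enumeration[OF c(2)]) (rule that)
    have v_in: "v j \<in> X" if "j < k" for j
      using kv(3) orbit_sub that by blast
    have unique: "\<exists>!i. i < k \<and> v i \<rightarrow>\<^bsub>G\<^esub> \<omega>" if "\<omega> \<in> entrances" for \<omega>
    proof -
      \<comment> \<open>The index sought is the one with \<open>v i = T \<omega>\<close>;
        injectivity of \<open>v\<close> makes it unique.\<close>
      have "\<omega> \<in> X" "T \<omega> \<in> v ` {..<k}" using that kv(3) by (auto simp: entrances_def)
      then show ?thesis
        using kv(2) unfolding G dominates_map_digraph by (auto simp: inj_on_def)
    qed
    have "cond_ii"
      unfolding assms(7)
    \<comment> \<open>If the cycle exhausts \<open>X\<close>, there are no entrances and the
      partition is empty.\<close>
    proof (intro exI[of _ k] exI[of _ v] conjI exI[of _ "basin ` entrances"] ballI)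
      show "partition_on (verts G - v ` {..<k}) (basin ` entrances)"
        using partition_on_basins kv(3) G by simp
      show "\<exists>\<omega>. rooted_directed_tree (G \<restriction> R) \<omega> \<and> (\<exists>!i. i < k \<and> v i \<rightarrow>\<^bsub>G\<^esub> \<omega>)"
        if "R \<in> basin ` entrances" for R
        using that rooted_directed_tree_basin periodic unique G by blast
    qed (use kv v_in orbit_sub G in auto)
    then show ?thesis using \<open>\<not> cond_i\<close> by blast
  qed
qed

end
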